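(* Let $\mathcal D=\{D^1,\dots,D^m\}$ be a finite family of $m=|\mathcal D|$ (pairwise distinct) distributions of value profiles $(v_1,\dots,v_n)$ of $n$ bidders, with a common finite support, each satisfying the Crémer–McLean condition. Let $d$ be the dimension of the linear space spanned by $D^1,\dots,D^m$ (viewed as vectors of probabilities), and put $k=m-d+1$. Then there exists a single auction with $k$ samples that is dominant strategy incentive compatible and that, for every $D\in\mathcal D$, is interim individually rational under $D$ and extracts the full social surplus under $D$.
   Context: A single item is sold to $n$ bidders with nonnegative real private values $v_1,\dots,v_n$, where $(v_1,\dots,v_n)$ is drawn from a distribution $D$ with finite support $T$. $T_i$ is the set of values $v_i$ having positive probability, $T_{-i}$ the set of profiles $v_{-i}$ of the other bidders' values having positive probability. A distribution is regarded as the vector $(D(v))_{v\in T}\in\mathbb R^{|T|}$ of its probabilities. All distributions of a family have the same support. Crémer–McLean condition: for $v_i\in T_i$ let $D_{i,v_i}\in\mathbb R^{|T_{-i}|}$ be the vector of conditional probabilities $(D(v_{-i}\mid v_i))_{v_{-i}}$. $D$ satisfies the condition if for each bidder $i$ the $|T_i|$ vectors $\{D_{i,v_i}\}_{v_i\in T_i}$ are linearly independent. Auction with $k$ samples: the auctioneer observes $k$ value profiles $s=(s_1,\dots,s_k)\in T^k$, drawn independently from the true distribution $D$ and independently of the bidders' value profile. The auction consists of functions (not depending on which $D\in\mathcal D$ is the true one) giving allocation probabilities $x_i(v,s)\in[0,1]$ with $\sum_i x_i(v,s)\le 1$ and payments $p_i(v,s)\in\mathbb R$ (possibly negative), for each reported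 profile $v\in\prod_i T_i$ and each $s\in T^k$. Bidder $i$'s utility is $v_ix_i-p_i$. Dominant strategy incentive compatible: $v_i x_i(v_i,v_{-i},s)-p_i(v_i,v_{-i},s)\ge v_i x_i(v_i',v_{-i},s)-p_i(v_i',v_{-i},s)$ for all $i,v_i,v_i',v_{-i},s$. Interim individually rational under $D$: for all $i$ and $v_i\in T_i$, $\mathbf E[v_i x_i(v,s)-p_i(v,s)\mid v_i]\ge 0$, where $v_{-i}$ is drawn from $D$ conditioned on $v_i$ and the samples are i.i.d. from $D$. Extracts the full social surplus under $D$: the item is always allocated to a bidder with the highest value, and each bidder's expected utility is zero, so that the expected sum of payments equals $\mathbf E_{v\sim D}[\max_i v_i]$. *)

theory Defs
  imports "HOL-Probability.Probability" "HOL-Library.Function_Algebras"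
begin

text \<open>
  Vectors indexed by a set of profiles are real functions that vanish outside that set, so we
  make functions into a real vector space; \<open>independent\<close> and \<open>dim\<close> then apply to them.
\<close>

instantiation "fun" :: (type, real_vector) real_vector
begin

definition scaleR_fun_def: "scaleR c f = (\<lambda>x. scaleR c (f x))"

instance
  by standard (simp_all add: scaleR_fun_def fun_eq_iff scaleR_add_right scaleR_add_left)

end

text \<open>
  Bidders are the elements of a finite type \<open>'n\<close>. Types are nonempty, so there is at least one
  bidder.
\<close>

type_synonym 'n profile = "'n \<Rightarrow> real"

definition value_set :: "'n profile set \<Rightarrow> 'n \<Rightarrow> real set" where
  "value_set T i = (\<lambda>v. v i) ` T"

text \<open>All of \<open>\<Prod>i. T\<^sub>i\<close>, in general a proper superset of \<open>T\<close>.\<close>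

definition reports :: "'n profile set \<Rightarrow> 'n profile set" where
  "reports T = {v. \<forall>i. v i \<in> value_set T i}"

definition samples :: "'n profile set \<Rightarrow> nat \<Rightarrow> 'n profile list set" where
  "samples T k = {s. length s = k \<and> set s \<subseteq> T}"

text \<open>
  The conditional distribution of \<open>v\<^sub>-\<^sub>i\<close> given \<open>v\<^sub>i = t\<close>, where \<open>v\<^sub>-\<^sub>i\<close> is the restriction of \<open>v\<close>
  to the bidders other than \<open>i\<close>. Meaningful for \<open>t \<in> value_set (set_pmf D) i\<close>.
\<close>

definition cond_others :: "'n profile pmf \<Rightarrow> 'n \<Rightarrow> real \<Rightarrow> 'n profile pmf" where
  "cond_others D i t = map_pmf (\<lambda>v. restrict v (- {i})) (cond_pmf D {v. v i = t})"

text \<open>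
  Independence is that of an indexed family, hence the injectivity: two values must not induce
  the same conditional distribution.
\<close>

definition cremer_mclean :: "'n profile pmf \<Rightarrow> bool" where
  "cremer_mclean D \<longleftrightarrow>
    (\<forall>i. inj_on (\<lambda>t. pmf (cond_others D i t)) (value_set (set_pmf D) i) \<and>
         independent ((\<lambda>t. pmf (cond_others D i t)) ` value_set (set_pmf D) i))"

text \<open>
  An auction is a pair of an allocation rule \<open>x\<close> and a payment rule \<open>p\<close>, whose arguments are the
  bidder, the reported profile and the list of samples. Only its values on
  \<open>reports T \<times> samples T k\<close> matter.
\<close>

type_synonym 'n rule = "'n \<Rightarrow> 'n profile \<Rightarrow> 'n profile list \<Rightarrow> real"

definition feasible :: "('n::finite) profile set \<Rightarrow> nat \<Rightarrow> 'n rule \<Rightarrow> bool" where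
  "feasible T k x \<longleftrightarrow>
    (\<forall>v\<in>reports T. \<forall>s\<in>samples T k.
       (\<forall>i. 0 \<le> x i v s \<and> x i v s \<le> 1) \<and> (\<Sum>i\<in>UNIV. x i v s) \<le> 1)"

definition dsic :: "'n profile set \<Rightarrow> nat \<Rightarrow> 'n rule \<Rightarrow> 'n rule \<Rightarrow> bool" where
  "dsic T k x p \<longleftrightarrow>
    (\<forall>v\<in>reports T. \<forall>s\<in>samples T k. \<forall>i. \<forall>t\<in>value_set T i.
       v i * x i v s - p i v s \<ge> v i * x i (v(i := t)) s - p i (v(i := t)) s)"

definition interim_ir :: "'n profile pmf \<Rightarrow> nat \<Rightarrow> 'n rule \<Rightarrow> 'n rule \<Rightarrow> bool" where
  "interim_ir D k x p \<longleftrightarrow>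
    (\<forall>i. \<forall>t\<in>value_set (set_pmf D) i.
       measure_pmf.expectation (pair_pmf (cond_pmf D {v. v i = t}) (replicate_pmf k D))
         (\<lambda>(v, s). v i * x i v s - p i v s) \<ge> 0)"

definition extracts_full_surplus ::
    "('n::finite) profile pmf \<Rightarrow> nat \<Rightarrow> 'n rule \<Rightarrow> 'n rule \<Rightarrow> bool" where
  "extracts_full_surplus D k x p \<longleftrightarrow>
    (\<forall>v\<in>reports (set_pmf D). \<forall>s\<in>samples (set_pmf D) k.
       (\<Sum>i | \<forall>j. v j \<le> v i. x i v s) = 1) \<and>
    (\<forall>i. measure_pmf.expectation (pair_pmf D (replicate_pmf k D))
           (\<lambda>(v, s). v i * x i v s - p i v s) = 0) \<and>
    measure_pmf.expectation (pair_pmf D (replicate_pmf k D)) (\<lambda>(v, s). \<Sum>i\<in>UNIV. p i v s) =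
      measure_pmf.expectation D (\<lambda>v. Max (range v))"

end

theory Submission
  imports Defs
begin

text \<open>
  Run the second-price auction and charge bidder \<open>i\<close> a fee that depends only on the other reports
  and on the samples, so that truthfulness is untouched. For each \<open>D\<close> the Cremer-McLean condition
  gives a function \<open>\<psi>\<^sub>D\<close> of the other reports whose conditional expectation under \<open>D\<close> is the
  second-price utility of every type. A statistic \<open>g\<^sub>D\<close> of the samples with expectation 1 under
  \<open>D\<close> and 0 under the rest of the family then makes \<open>\<Sum>\<^sub>D g\<^sub>D \<psi>\<^sub>D\<close> a fee that works for all
  distributions at once.

  To build \<open>g\<^sub>D\<close>, extend \<open>D\<close> to a basis of the span by \<open>d - 1\<close> other members of the family. One
  sample suffices to annihilate those, by a linear functional that is 1 at \<open>D\<close>, and one more sample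
  annihilates each of the remaining \<open>m - d\<close> distributions. The product of these functions of
  separate samples is \<open>g\<^sub>D\<close>.
\<close>

section \<open>Functions with prescribed expectations\<close>

lemma sum_fun_apply: "(\<Sum>a\<in>A. f a) x = (\<Sum>a\<in>A. f a x)"
  by (induction A rule: infinite_finite_induct) auto

text \<open>A finitely supported pmf is a combination of point masses. This turns an abstract
  functional into a function that can be evaluated at a draw.\<close>

lemma linear_pmf_eq_expectation:
  fixes F :: "('a \<Rightarrow> real) \<Rightarrow> real"
  assumes "linear F" "finite (set_pmf D)"
  shows "F (pmf D) = measure_pmf.expectation D (\<lambda>a. F (indicator {a}))"
proof -
  have "pmf D = (\<Sum>a\<in>set_pmf D. pmf D a *\<^sub>R indicator {a})"
  proof
    fix x
    have "(\<Sum>a\<in>set_pmf D. pmf D a * indicator {a} x) = (\<Sum>a\<in>set_pmf D. if a = x then pmf D x else 0)"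
      by (intro sum.cong) (auto simp: indicator_def)
    also have "\<dots> = pmf D x"
      using assms(2) by (simp add: set_pmf_iff)
    finally show "pmf D x = (\<Sum>a\<in>set_pmf D. pmf D a *\<^sub>R (indicator {a} :: 'a \<Rightarrow> real)) x"
      by (simp add: sum_fun_apply scaleR_fun_def)
  qed
  then have "F (pmf D) = F (\<Sum>a\<in>set_pmf D. pmf D a *\<^sub>R indicator {a})"
    by simp
  also have "\<dots> = (\<Sum>a\<in>set_pmf D. pmf D a *\<^sub>R F (indicator {a}))"
    using assms(1) by (simp add: linear_sum linear_scale)
  also have "\<dots> = measure_pmf.expectation D (\<lambda>a. F (indicator {a}))"
    using assms(2) by (subst integral_measure_pmf[of "set_pmf D"]) auto
  finally show ?thesis .
qed

text \<open>A linear functional can be prescribed freely on independent vectors. This serves twice: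
  for a basis of the span of the family, and for the conditional distributions in the Cremer-McLean
  condition.\<close>

lemma exists_expectations:
  fixes P :: "'i \<Rightarrow> 'a pmf" and c :: "'i \<Rightarrow> real"
  assumes fin: "\<And>t. t \<in> I \<Longrightarrow> finite (set_pmf (P t))"
    and inj: "inj_on (\<lambda>t. pmf (P t)) I"
    and indep: "independent ((\<lambda>t. pmf (P t)) ` I)"
  obtains h where "\<And>t. t \<in> I \<Longrightarrow> measure_pmf.expectation (P t) h = c t"
proof -
  obtain F :: "('a \<Rightarrow> real) \<Rightarrow> real" where F: "linear F"
    "\<And>q. q \<in> (\<lambda>t. pmf (P t)) ` I \<Longrightarrow> F q = c (the_inv_into I (\<lambda>t. pmf (P t)) q)"
    using linear_independent_extend[OF indep,
        of "\<lambda>q. c (the_inv_into I (\<lambda>t. pmf (P t)) q)"] by auto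
  have "measure_pmf.expectation (P t) (\<lambda>a. F (indicator {a})) = c t" if "t \<in> I" for t
    unfolding linear_pmf_eq_expectation[OF F(1) fin[OF that], symmetric] F(2)[OF imageI[OF that]]
    by (simp only: the_inv_into_f_f[OF inj that])
  then show thesis
    by (rule that)
qed

text \<open>Take the indicator of a point where the two probabilities differ and rescale it
  affinely.\<close>

lemma exists_separating_function:
  assumes "P \<noteq> Q"
  obtains h :: "'a \<Rightarrow> real"
    where "measure_pmf.expectation P h = 1" "measure_pmf.expectation Q h = 0"
proof -
  obtain a where a: "pmf P a \<noteq> pmf Q a"
    using assms by (auto intro: pmf_eqI)
  define h :: "'a \<Rightarrow> real" where "h = (\<lambda>x. (indicator {a} x - pmf Q a) / (pmf P a - pmf Q a))"
  have "measure_pmf.expectation R h = (pmf R a - pmf Q a) / (pmf P a - pmf Q a)" for R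
  proof -
    have "integrable (measure_pmf R) (indicator {a} :: 'a \<Rightarrow> real)"
      by (rule measure_pmf.integrable_const_bound[where B = 1]) auto
    then have "measure_pmf.expectation R (\<lambda>x. indicator {a} x - pmf Q a) = pmf R a - pmf Q a"
      by (subst Bochner_Integration.integral_diff) (auto simp: measure_pmf_single)
    then show ?thesis
      unfolding h_def by simp
  qed
  then show thesis
    using a that[of h] by simp
qed

section \<open>Sample statistics\<close>

definition sample_stat :: "('a \<Rightarrow> real) list \<Rightarrow> 'a list \<Rightarrow> real" where
  "sample_stat hs s = prod_list (map2 (\<lambda>h x. h x) hs s)"

text \<open>The samples are independent, so the expectation of the product factors; the induction
  splits off the first sample.\<close>

lemma expectation_sample_stat:
  assumes "finite (set_pmf D)"
  shows "measure_pmf.expectation (replicate_pmf (length hs) D) (sample_stat hs) =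
    prod_list (map (measure_pmf.expectation D) hs)"
proof (induction hs)
  case Nil
  then show ?case
    by (simp add: sample_stat_def)
next
  case (Cons h hs)
  let ?R = "replicate_pmf (length hs) D"
  have fin: "finite (set_pmf ?R)"
    using finite_lists_length_eq[OF assms, of "length hs"]
    by (auto simp: set_replicate_pmf elim!: rev_finite_subset)
  have "measure_pmf.expectation (replicate_pmf (length (h # hs)) D) (sample_stat (h # hs)) =
    (\<Sum>a\<in>set_pmf D. pmf D a *\<^sub>R measure_pmf.expectation (map_pmf ((#) a) ?R) (sample_stat (h # hs)))"
    using assms fin by (simp add: map_pmf_def[symmetric] pmf_expectation_bind[of "set_pmf D"])
  also have "\<dots> = (\<Sum>a\<in>set_pmf D. pmf D a *\<^sub>R (h a * measure_pmf.expectation ?R (sample_stat hs)))"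
    by (simp add: sample_stat_def[abs_def])
  also have "\<dots> = (\<Sum>a\<in>set_pmf D. pmf D a *\<^sub>R h a) * measure_pmf.expectation ?R (sample_stat hs)"
    by (simp add: sum_distrib_right mult.assoc)
  also have "(\<Sum>a\<in>set_pmf D. pmf D a *\<^sub>R h a) = measure_pmf.expectation D h"
    using assms by (subst integral_measure_pmf[of "set_pmf D"]) auto
  finally show ?case
    using Cons.IH by simp
qed

lemma exists_separating_sample_stat:
  fixes \<D> :: "'a pmf set"
  assumes "finite \<D>" "D \<in> \<D>"
    and fin: "\<And>Q. Q \<in> \<D> \<Longrightarrow> finite (set_pmf Q)"
    and k: "k = card \<D> - dim (pmf ` \<D>) + 1"
  obtains g :: "'a list \<Rightarrow> real" where "\<And>Q. Q \<in> \<D> \<Longrightarrow>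
    measure_pmf.expectation (replicate_pmf k Q) g = (if Q = D then 1 else 0)"
proof -
  \<comment> \<open>The basis has to contain \<open>pmf D\<close>, which is possible because this
    vector is nonzero.\<close>
  obtain a where "a \<in> set_pmf D"
    using set_pmf_not_empty by fast
  then have "pmf D \<noteq> 0"
    by (auto simp: set_pmf_iff fun_eq_iff)
  then have "independent {pmf D}"
    by simp
  then obtain B where B: "{pmf D} \<subseteq> B" "B \<subseteq> pmf ` \<D>" "independent B" "pmf ` \<D> \<subseteq> span B"
    using maximal_independent_subset_extend[of "{pmf D}" "pmf ` \<D>"] assms(2) by blast
  have inj: "inj_on pmf X" for X :: "'a pmf set"
    by (rule inj_onI) (rule pmf_eqI, simp)
  define \<B> where "\<B> = {Q\<in>\<D>. pmf Q \<in> B}"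
  have \<B>: "\<B> \<subseteq> \<D>" "D \<in> \<B>" "pmf ` \<B> = B"
    using B assms(2) by (auto simp: \<B>_def)
  have "dim (pmf ` \<D>) = card \<B>"
    using basis_card_eq_dim[OF B(2,4,3)] card_image[OF inj, of \<B>] \<B>(3) by simp
  \<comment> \<open>One sample serves the whole basis, and one more each of the m - d distributions
    outside it.\<close>
  then have "card (\<D> - \<B>) + 1 = k"
    using k \<B>(1) assms(1) by (simp add: card_Diff_subset finite_subset)
  obtain f :: "'a \<Rightarrow> real" where
    f: "\<And>Q. Q \<in> \<B> \<Longrightarrow> measure_pmf.expectation Q f = (if Q = D then 1 else 0)"
    using exists_expectations[of \<B> "\<lambda>Q. Q" "\<lambda>Q. if Q = D then 1 else 0"] fin \<B> B(3)
      inj[of \<B>] by blast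
  have "\<exists>h :: 'a \<Rightarrow> real. Q \<noteq> D \<longrightarrow>
      measure_pmf.expectation D h = 1 \<and> measure_pmf.expectation Q h = 0" for Q
    using exists_separating_function[of D Q] by metis
  then obtain h :: "'a pmf \<Rightarrow> 'a \<Rightarrow> real" where
    h: "\<And>Q. Q \<noteq> D \<Longrightarrow> measure_pmf.expectation D (h Q) = 1"
       "\<And>Q. Q \<noteq> D \<Longrightarrow> measure_pmf.expectation Q (h Q) = 0"
    by metis
  obtain Qs where Qs: "set Qs = \<D> - \<B>" "distinct Qs"
    using finite_distinct_list[of "\<D> - \<B>"] assms(1) by blast
  define hs where "hs = f # map h Qs"
  have "length hs = k"
    using \<open>card (\<D> - \<B>) + 1 = k\<close> Qs distinct_card[of Qs] by (simp add: hs_def)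
  have "prod_list (map (measure_pmf.expectation Q) hs) = (if Q = D then 1 else 0)" if "Q \<in> \<D>" for Q
  proof (cases "Q = D")
    case True
    have "Q' \<noteq> D" if "Q' \<in> set Qs" for Q'
      using that Qs(1) \<B>(2) by blast
    then have "map (\<lambda>Q. measure_pmf.expectation D (h Q)) Qs = map (\<lambda>_. 1) Qs"
      by (simp add: h(1))
    then have "prod_list (map (measure_pmf.expectation D) (map h Qs)) = 1"
      by (simp add: o_def map_replicate_const)
    moreover have "measure_pmf.expectation D f = 1"
      using f[OF \<B>(2)] by simp
    ultimately show ?thesis
      using True by (simp add: hs_def)
  next
    case False
    \<comment> \<open>One vanishing factor is enough: \<open>f\<close> if \<open>Q\<close> is in the
      basis, \<open>h Q\<close> otherwise. The other factors may have any expectation under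
      \<open>Q\<close>.\<close>
    have "0 \<in> set (map (measure_pmf.expectation Q) hs)"
    proof (cases "Q \<in> \<B>")
      case True
      then show ?thesis
        using f False by (simp add: hs_def)
    next
      case notin: False
      then have "h Q \<in> set hs"
        using Qs(1) that by (simp add: hs_def)
      then have "measure_pmf.expectation Q (h Q) \<in> set (map (measure_pmf.expectation Q) hs)"
        by simp
      then show ?thesis
        by (simp only: h(2)[OF False])
    qed
    then show ?thesis
      using False by (simp only: prod_list_zero_iff if_False)
  qed
  then show thesis
    using that[of "sample_stat hs"] expectation_sample_stat[OF fin, of _ hs] \<open>length hs = k\<close>
    by simp
qed

section \<open>Expectations over profiles and samples\<close>

lemma expectation_pair_pmf_mult:
  fixes f :: "'a \<Rightarrow> real"
  assumes "finite (set_pmf P)" "finite (set_pmf Q)"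
  shows "measure_pmf.expectation (pair_pmf P Q) (\<lambda>(v, s). f v * g s) =
    measure_pmf.expectation P f * measure_pmf.expectation Q g"
proof -
  have "measure_pmf.expectation (pair_pmf P Q) (\<lambda>(v, s). f v * g s) =
      (\<Sum>(v, s)\<in>set_pmf P \<times> set_pmf Q. (pmf P v * f v) * (pmf Q s * g s))"
    using assms
    by (subst integral_measure_pmf[of "set_pmf P \<times> set_pmf Q"])
      (auto intro!: sum.cong simp: pmf_pair)
  also have "\<dots> = (\<Sum>v\<in>set_pmf P. pmf P v * f v) * (\<Sum>s\<in>set_pmf Q. pmf Q s * g s)"
    by (simp add: sum_product sum.cartesian_product)
  also have "\<dots> = measure_pmf.expectation P f * measure_pmf.expectation Q g"
    using assms
    by (simp add: integral_measure_pmf[of "set_pmf P" P] integral_measure_pmf[of "set_pmf Q" Q])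
  finally show ?thesis .
qed

text \<open>Disintegration of \<open>D\<close> along \<open>X\<close>, the source of the law of
  total expectation used below.\<close>

lemma bind_cond_pmf_fibre:
  "map_pmf X D \<bind> (\<lambda>t. cond_pmf D {v. X v = t}) = D"
proof (rule bind_cond_pmf_cancel)
  fix t v
  assume "X v = t"
  then show "measure D {v. X v = t} = measure (map_pmf X D) {u. X v = u}"
    by (auto intro!: arg_cong[where f = "measure D"])
qed auto

lemma expectation_pair_eq_0_if_conditional:
  fixes f :: "'a \<times> 'b \<Rightarrow> real"
  assumes fin: "finite (set_pmf D)" "finite (set_pmf S)"
    and 0: "\<And>t. t \<in> X ` set_pmf D \<Longrightarrow>
      measure_pmf.expectation (pair_pmf (cond_pmf D {v. X v = t}) S) f = 0"
  shows "measure_pmf.expectation (pair_pmf D S) f = 0"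
proof -
  have fibre: "finite (set_pmf (cond_pmf D {v. X v = t}))" if "t \<in> X ` set_pmf D" for t
    using that fin(1) by (subst set_cond_pmf) auto
  have "pair_pmf D S = map_pmf X D \<bind> (\<lambda>t. pair_pmf (cond_pmf D {v. X v = t}) S)"
    by (subst bind_cond_pmf_fibre[of X D, symmetric]) (simp only: pair_pmf_def bind_assoc_pmf)
  then show ?thesis
    using fin fibre 0 by (simp add: pmf_expectation_bind[of "X ` set_pmf D"])
qed

section \<open>The second-price auction\<close>

text \<open>
  Inserting 0 makes the maximum well defined when there is only one bidder; for nonnegative values
  it changes nothing otherwise.
\<close>

definition rival_max :: "'n::finite \<Rightarrow> 'n profile \<Rightarrow> real" where
  "rival_max i v = Max (insert 0 (v ` (- {i})))"

definition winner :: "'n::finite profile \<Rightarrow> 'n" where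
  "winner v = (SOME i. \<forall>j. v j \<le> v i)"

definition alloc :: "'n::finite \<Rightarrow> 'n profile \<Rightarrow> real" where
  "alloc i v = (if i = winner v then 1 else 0)"

lemma le_winner: "v j \<le> v (winner v)"
proof -
  have "Max (range v) \<in> range v"
    by (rule Max_in) auto
  then obtain i where "v i = Max (range v)"
    by force
  then have "\<exists>i. \<forall>j. v j \<le> v i"
    by (metis Max_ge finite finite_imageI rangeI)
  then show ?thesis
    unfolding winner_def by (rule someI2_ex) blast
qed

lemma Max_range_eq_winner: "Max (range v) = v (winner v)"
  by (rule Max_eqI) (auto simp: le_winner)

lemma sum_alloc: "(\<Sum>i\<in>A. f i * alloc i v) = (if winner v \<in> A then f (winner v) else 0)"
  for A :: "'n::finite set"
  by (simp add: alloc_def if_distrib[of "(*) _"] cong: if_cong)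

lemma rival_max_update: "rival_max i (v(i := t)) = rival_max i v"
  unfolding rival_max_def by (intro arg_cong[where f = Max] arg_cong[where f = "insert 0"]) auto

lemma restrict_update: "restrict (v(i := t)) (- {i}) = restrict v (- {i})"
  by (auto simp: restrict_def)

text \<open>The winner's value is at least 0 and at least every rival value, while a loser faces a
  rival at least as high. Hence the choice among tied bidders does not affect utilities.\<close>

lemma second_price_utility_eq:
  assumes "\<And>j. 0 \<le> v j"
  shows "alloc i v * (v i - rival_max i v) = max 0 (v i - rival_max i v)"
proof (cases "i = winner v")
  case True
  then have "rival_max i v \<le> v i"
    using assms by (auto simp: rival_max_def le_winner)
  then show ?thesis
    using True by (simp add: alloc_def)
next
  case False
  then have "v (winner v) \<le> rival_max i v"
    unfolding rival_max_def by (intro Max_ge) auto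
  then have "v i \<le> rival_max i v"
    using le_winner[of v i] by linarith
  then show ?thesis
    using False by (simp add: alloc_def)
qed

text \<open>The price does not depend on the own report, so a deviation yields either 0 or the
  margin; truth yields the larger of the two.\<close>

lemma second_price_truthful:
  assumes "\<And>j. 0 \<le> v j"
  shows "alloc i (v(i := t)) * (v i - rival_max i v) \<le> alloc i v * (v i - rival_max i v)"
proof -
  have "alloc i (v(i := t)) * (v i - rival_max i v) \<le> max 0 (v i - rival_max i v)"
    by (simp add: alloc_def)
  then show ?thesis
    using second_price_utility_eq[of v i] assms by simp
qed

section \<open>Full surplus extraction\<close>

lemma finite_cond_others:
  assumes "finite (set_pmf D)" "t \<in> value_set (set_pmf D) i"
  shows "finite (set_pmf (cond_others D i t))"
proof -
  have "set_pmf D \<inter> {v. v i = t} \<noteq> {}"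
    using assms(2) by (auto simp: value_set_def)
  then show ?thesis
    using assms(1) by (simp add: cond_others_def)
qed

theorem theorem1:
  fixes \<D> :: "('n::finite) profile pmf set"
    and T :: "'n profile set"
    and k :: nat
  assumes "finite \<D>" and "\<D> \<noteq> {}"
    and "finite T"
    and "\<And>D. D \<in> \<D> \<Longrightarrow> set_pmf D = T"
    and "\<And>v i. v \<in> T \<Longrightarrow> v i \<ge> 0"
    and "\<And>D. D \<in> \<D> \<Longrightarrow> cremer_mclean D"
    and "k = card \<D> - dim (pmf ` \<D>) + 1"
  shows "\<exists>x p. feasible T k x \<and> dsic T k x p \<and>
           (\<forall>D\<in>\<D>. interim_ir D k x p \<and> extracts_full_surplus D k x p)"
proof -
  have fin: "finite (set_pmf D)" if "D \<in> \<D>" for D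
    using that assms(3,4) by simp
  have "\<exists>g :: _ \<Rightarrow> real. \<forall>Q\<in>\<D>. measure_pmf.expectation (replicate_pmf k Q) g = (if Q = D then 1 else 0)"
    if "D \<in> \<D>" for D
    using exists_separating_sample_stat[OF assms(1) that fin assms(7)] by metis
  then obtain g :: "'n profile pmf \<Rightarrow> 'n profile list \<Rightarrow> real" where g: "\<And>D Q. D \<in> \<D> \<Longrightarrow> Q \<in> \<D> \<Longrightarrow>
      measure_pmf.expectation (replicate_pmf k Q) (g D) = (if Q = D then 1 else 0)"
    by metis
  define u where "u i v = alloc i v * (v i - rival_max i v)" for i and v :: "'n profile"
  \<comment> \<open>Although \<open>u i\<close> depends on the own value and \<open>h\<close> does
    not, independence across types lets one \<open>h\<close> meet the equations of all
    types.\<close>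
  have "\<exists>h. \<forall>t\<in>value_set (set_pmf D) i. measure_pmf.expectation (cond_others D i t) h =
      measure_pmf.expectation (cond_pmf D {v. v i = t}) (u i)" if "D \<in> \<D>" for D i
    using assms(6)[OF that] exists_expectations[of "value_set (set_pmf D) i" "cond_others D i"
        "\<lambda>t. measure_pmf.expectation (cond_pmf D {v. v i = t}) (u i)"]
      finite_cond_others[OF fin[OF that]]
    unfolding cremer_mclean_def by metis
  then obtain h where h: "\<And>D i t. D \<in> \<D> \<Longrightarrow> t \<in> value_set (set_pmf D) i \<Longrightarrow>
      measure_pmf.expectation (cond_others D i t) (h D i) =
      measure_pmf.expectation (cond_pmf D {v. v i = t}) (u i)"
    by metis
  \<comment> \<open>The restriction hides the own report; in expectation, \<open>g D\<close>
    switches its summand on only under \<open>D\<close>.\<close>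
  define fee where "fee i v s = (\<Sum>D\<in>\<D>. h D i (restrict v (- {i})) * g D s)" for i v s
  define x :: "'n rule" where "x i v s = alloc i v" for i v s
  define p :: "'n rule" where "p i v s = alloc i v * rival_max i v + fee i v s" for i v s
  have utility: "v i * x i v s - p i v s = u i v - fee i v s" for i v s
    by (simp add: x_def p_def u_def algebra_simps)
  have finS: "finite (set_pmf (replicate_pmf k D))" if "D \<in> \<D>" for D
    using finite_lists_length_eq[OF fin[OF that], of k]
    by (auto simp: set_replicate_pmf elim!: rev_finite_subset)
  \<comment> \<open>Equality, rather than just nonnegativity, gives individual rationality and,
    averaged over types, the zero utilities of full extraction.\<close>
  have interim: "measure_pmf.expectation
        (pair_pmf (cond_pmf D {v. v i = t}) (replicate_pmf k D))
        (\<lambda>(v, s). v i * x i v s - p i v s) = 0"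
    if D: "D \<in> \<D>" and t: "t \<in> value_set (set_pmf D) i" for D i t
  proof -
    let ?C = "cond_pmf D {v. v i = t}" and ?S = "replicate_pmf k D"
    have ne: "set_pmf D \<inter> {v. v i = t} \<noteq> {}"
      using t by (auto simp: value_set_def)
    have finC: "finite (set_pmf ?C)"
      using ne fin[OF D] by simp
    have int: "integrable (measure_pmf (pair_pmf ?C ?S)) f" for f :: "_ \<Rightarrow> real"
      using finC finS[OF D] by (intro integrable_measure_pmf_finite) auto
    have "measure_pmf.expectation (pair_pmf ?C ?S) (\<lambda>(v, s). fee i v s) =
        (\<Sum>Q\<in>\<D>. measure_pmf.expectation (pair_pmf ?C ?S)
          (\<lambda>(v, s). h Q i (restrict v (- {i})) * g Q s))"
      unfolding fee_def case_prod_unfold by (intro Bochner_Integration.integral_sum int)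
    \<comment> \<open>The samples are independent of the profile, so each summand factors.\<close>
    also have "\<dots> = (\<Sum>Q\<in>\<D>. measure_pmf.expectation (cond_others D i t) (h Q i) *
        (if D = Q then 1 else 0))"
      using g D
      by (intro sum.cong refl)
        (simp add: expectation_pair_pmf_mult[OF finC finS[OF D]] cond_others_def)
    also have "\<dots> = measure_pmf.expectation ?C (u i)"
      using h[OF D t] D assms(1) by (simp add: if_distrib[of "(*) _"] cong: if_cong)
    finally have "measure_pmf.expectation (pair_pmf ?C ?S) (\<lambda>(v, s). fee i v s) =
      measure_pmf.expectation (pair_pmf ?C ?S) (\<lambda>vs. u i (fst vs))"
      by simp
    then show ?thesis
      unfolding utility case_prod_unfold
      by (subst Bochner_Integration.integral_diff[OF int int]) simp
  qed
  have nonneg: "0 \<le> v j" if "v \<in> reports T" for v j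
    using that assms(5) unfolding reports_def value_set_def by (smt (verit) imageE mem_Collect_eq)
  have "feasible T k x"
    using sum_alloc[where f = "\<lambda>_. 1" and A = UNIV] by (simp add: feasible_def x_def alloc_def)
  moreover have "dsic T k x p"
    unfolding dsic_def
  proof (intro ballI allI)
    fix v s i t
    assume "v \<in> reports T"
    have "alloc i (v(i := t)) * (v i - rival_max i v) \<le> u i v"
      unfolding u_def by (rule second_price_truthful[OF nonneg[OF \<open>v \<in> reports T\<close>]])
    \<comment> \<open>The fee is the same on both sides and cancels.\<close>
    then show "v i * x i (v(i := t)) s - p i (v(i := t)) s \<le> v i * x i v s - p i v s"
      unfolding utility
      by (simp add: x_def p_def fee_def restrict_update rival_max_update algebra_simps)
  qed
  moreover have "interim_ir D k x p" if "D \<in> \<D>" for D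
    using interim[OF that] by (simp add: interim_ir_def)
  moreover have "extracts_full_surplus D k x p" if D: "D \<in> \<D>" for D
  proof -
    let ?P = "pair_pmf D (replicate_pmf k D)"
    have int: "integrable (measure_pmf ?P) f" for f :: "_ \<Rightarrow> real"
      using fin[OF D] finS[OF D] by (intro integrable_measure_pmf_finite) auto
    have zero: "measure_pmf.expectation ?P (\<lambda>(v, s). v i * x i v s - p i v s) = 0" for i
      using interim[OF D, unfolded value_set_def]
      by (rule expectation_pair_eq_0_if_conditional[OF fin[OF D] finS[OF D]])
    \<comment> \<open>Revenue is welfare minus utilities, and welfare is the highest value because
      the winner has it.\<close>
    have pay: "(\<Sum>i\<in>UNIV. p i v s) =
        Max (range v) - (\<Sum>i\<in>UNIV. v i * x i v s - p i v s)" for v s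
      by (simp add: x_def sum_subtractf sum_alloc Max_range_eq_winner)
    have "measure_pmf.expectation ?P (\<lambda>(v, s). \<Sum>i\<in>UNIV. p i v s) =
        measure_pmf.expectation ?P (\<lambda>vs. Max (range (fst vs))) -
        (\<Sum>i\<in>UNIV. measure_pmf.expectation ?P (\<lambda>(v, s). v i * x i v s - p i v s))"
      unfolding pay case_prod_unfold
      by (simp only: Bochner_Integration.integral_diff[OF int int]
          Bochner_Integration.integral_sum[OF int])
    also have "\<dots> = measure_pmf.expectation D (\<lambda>v. Max (range v))"
      by (simp add: zero expectation_pair_pmf_fst[where f = "\<lambda>v. Max (range v)"])
    finally show ?thesis
      using zero
      by (simp add: extracts_full_surplus_def x_def le_winner
          sum_alloc[where f = "\<lambda>_. 1", simplified])
  qed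
  ultimately show ?thesis
    by blast
qed

end
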